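(* Let $\mathcal{B}^i(f,f_{(1)},f_{(2)},f_{(1,2)};\beta_1,\beta_2)=0$, $i=1,2$, be a system of lattice (quad-graph) equations for a two-component field $f=(f^1,f^2)$. Suppose that the system satisfies the three-dimensional consistency property and admits a two-parameter group $G$ of (Lie point) symmetry transformations. Let $R(\beta_1,\beta_2):(x,y)\mapsto(p,q)$ be the map relating the edge lattice invariants $$x^i=I^i(f,f_{(1)}),\quad y^i=I^i(f_{(2)},f),\quad p^i=I^i(f_{(2)},f_{(1,2)}),\quad q^i=I^i(f_{(1,2)},f_{(1)}),\qquad i=1,2,$$ where $I^1,I^2$ are lattice invariants of $G$, it being assumed that the relations among these invariants determine $(p,q)$ uniquely in terms of $(x,y)$. Then $R$ satisfies the parameter-dependent Yang-Baxter relation $$R^{(2,3)}(\beta_2,\beta_3)\,R^{(1,3)}(\beta_1,\beta_3)\,R^{(1,2)}(\beta_1,\beta_2)=R^{(1,2)}(\beta_1,\beta_2)\,R^{(1,3)}(\beta_1,\beta_3)\,R^{(2,3)}(\beta_2,\beta_3).$$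
   Context: The field is $f=(f^1,f^2)$ with $f^i$ a function on the lattice sites with values in $\mathbb{C}$ (or $\mathbb{CP}^1$). On an elementary square of the orthogonal grid, $f,f_{(1)},f_{(2)},f_{(1,2)}$ denote the values at a base vertex, at its neighbours in directions 1 and 2, and at the opposite vertex; a complex parameter $\beta_i$ is attached to all edges in direction $i$ (parallel edges carry the same parameter). The system can be solved for $f_{(1,2)}$ in terms of $f,f_{(1)},f_{(2)}$. All statements concern generic values, where the (partially defined) maps involved are defined. Upper indices denote components. Three-dimensional consistency. Consider a path of consecutive vertices of the multidimensional grid with field values $f_j$ and edge parameters $\alpha_j$ on the edge joining the $j$-th and $(j+1)$-st vertices. The elementary flip $\mathbb{B}_k$ replaces $f_k$ by $\widetilde f_k$, the solution of $\mathcal{B}^i(f_k,f_{k-1},f_{k+1},\widetilde f_k;\alpha_{k-1},\alpha_k)=0$, $i=1,2$ (i.e. the roles of $f,f_{(1)},f_{(2)},f_{(1,2)}$ are played by $f_k,f_{k-1},f_{k+1},\widetilde f_k$), exchanges $\alpha_{k-1}$ and $\alpha_k$, and leaves everything else unchanged. The three-dimensional consistency property means that, for initial values on a path of four consecutive vertices whose three edges are edges in the three different directions of a cube, the values obtained at the flipped vertices do not depend on the way the path is deformed across the cube, i.e. $\mathbb{B}_{j+1}\mathbb{B}_j\mathbb{B}_{j+1}=\mathbb{B}_j\mathbb{B}_{j+1}\mathbb{B}_j$. Symmetries and invariants. A group of transformations $G$ acts on the dependent variables by point transformations $f^i\mapsto\Phi^i(n,f;\varepsilon)$ at each site $n$,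 with the prolonged action on shifted values given by applying the transformation at the shifted site. $G$ is a symmetry group of the system if it maps solutions to solutions. The group is generated by two vector fields $\mathbf v_1,\mathbf v_2$. A lattice invariant is a function of $f$ and its forward shifted values that is unchanged by the prolonged action of every element of $G$. The invariants $x,y,p,q$ (each with two components) are related by exactly two functional relations coming from the fact that the space of $G$-orbits on the space of $(f,f_{(1)},f_{(2)},f_{(1,2)})$ is six-dimensional; since $G$ is a symmetry group, the system $\mathcal{B}^i=0$ gives two further relations $\mathcal{D}^i(x,y,p,q;\beta_1,\beta_2)=0$, $i=1,2$. The map $R(\beta_1,\beta_2)$ is the unique solution of these four relations for $(p,q)$ in terms of $(x,y)$. For a map $R$ of $X\times X$ into itself, $R^{(i,j)}$ denotes the map of $X\times X\times X$ acting as $R$ on the $i$-th and $j$-th factors (in this order) and as the identity on the remaining factor; products are compositions. *)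

theory Defs
  imports "HOL-Analysis.Analysis" "HOL-Algebra.Group"
begin

text \<open>
  Values of the two-component field and of the two-component edge invariants, and parameters of
  a two-parameter group. The partially defined maps of the theory are modelled with explicit
  domains of definition, and \<open>generic\<close> means \<open>on an open dense set\<close>; the affine chart of a
  projective line is open and dense, so complex components suffice.
\<close>

type_synonym cvec = "complex^2"
type_synonym site = "int \<times> int"
type_synonym path = "(nat \<Rightarrow> cvec) \<times> (nat \<Rightarrow> complex)"
type_synonym quad_system = "cvec \<Rightarrow> cvec \<Rightarrow> cvec \<Rightarrow> cvec \<Rightarrow> complex \<Rightarrow> complex \<Rightarrow> complex^2"
type_synonym triples = "complex \<Rightarrow> complex \<Rightarrow> (cvec \<times> cvec \<times> cvec) set"

definition generic :: "'a::topological_space set \<Rightarrow> bool" where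
  "generic S \<longleftrightarrow> open S \<and> closure S = UNIV"

definition shift1 :: "site \<Rightarrow> site" where "shift1 n = (fst n + 1, snd n)"
definition shift2 :: "site \<Rightarrow> site" where "shift2 n = (fst n, snd n + 1)"

text \<open>Complex differentiability: the real derivative is given by complex matrices.\<close>

definition holomorphic1 :: "(cvec \<Rightarrow> cvec) \<Rightarrow> cvec set \<Rightarrow> bool" where
  "holomorphic1 F S \<longleftrightarrow>
     (\<forall>a\<in>S. \<exists>A :: complex^2^2. (F has_derivative (\<lambda>h. A *v h)) (at a))"

definition holomorphic2 :: "(cvec \<Rightarrow> cvec \<Rightarrow> cvec) \<Rightarrow> (cvec \<times> cvec) set \<Rightarrow> bool" where
  "holomorphic2 F S \<longleftrightarrow>
     (\<forall>(a, b)\<in>S. \<exists>(A :: complex^2^2) (B :: complex^2^2).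
        ((\<lambda>(a, b). F a b) has_derivative (\<lambda>(h, k). A *v h + B *v k)) (at (a, b)))"


text \<open>
  \<open>par\<close> is the set of parameter pairs under consideration. \<open>reg \<beta>1 \<beta>2\<close> is the open dense
  set of generic triples \<open>(f, f1, f2)\<close> at which all maps involved are defined: the solution
  \<open>f12\<close>, and, by hypotheses stated elsewhere, the four edge invariants of the square and the
  map of edge invariants. It is the domain of the partially defined flips.
\<close>

definition solvable :: "quad_system \<Rightarrow> (complex \<times> complex) set \<Rightarrow> triples \<Rightarrow> bool" where
  "solvable B par reg \<longleftrightarrow>
     (\<forall>(\<beta>1, \<beta>2)\<in>par. generic (reg \<beta>1 \<beta>2) \<and>
        (\<forall>(f, f1, f2)\<in>reg \<beta>1 \<beta>2. \<exists>!f12. B f f1 f2 f12 \<beta>1 \<beta>2 = 0))"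

text \<open>
  The elementary flip at the vertex \<open>k \<ge> 1\<close> of a path; \<open>\<alpha> j\<close> sits on the edge between the
  vertices \<open>j\<close> and \<open>j + 1\<close>.
\<close>

definition flip :: "quad_system \<Rightarrow> triples \<Rightarrow> nat \<Rightarrow> path \<rightharpoonup> path" where
  "flip B reg k = (\<lambda>(f, \<alpha>).
     if (f k, f (k - 1), f (k + 1)) \<in> reg (\<alpha> (k - 1)) (\<alpha> k)
     then Some (f(k := (THE g. B (f k) (f (k - 1)) (f (k + 1)) g (\<alpha> (k - 1)) (\<alpha> k) = 0)),
                \<alpha>(k - 1 := \<alpha> k, k := \<alpha> (k - 1)))
     else None)"

text \<open>For generic initial values both deformations of the path are defined and agree.\<close>

definition three_dim_consistent ::
    "quad_system \<Rightarrow> (complex \<times> complex) set \<Rightarrow> triples \<Rightarrow> bool" where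
  "three_dim_consistent B par reg \<longleftrightarrow>
     (\<forall>\<beta>1 \<beta>2 \<beta>3. (\<beta>1, \<beta>2) \<in> par \<and> (\<beta>1, \<beta>3) \<in> par \<and> (\<beta>2, \<beta>3) \<in> par \<longrightarrow>
        (\<exists>W. generic W \<and>
           (\<forall>f \<alpha> j. j \<ge> 1 \<and> \<alpha> (j - 1) = \<beta>1 \<and> \<alpha> j = \<beta>2 \<and> \<alpha> (j + 1) = \<beta>3 \<and>
              (f (j - 1), f j, f (j + 1), f (j + 2)) \<in> W \<longrightarrow>
              (flip B reg (j + 1) \<circ>\<^sub>m flip B reg j \<circ>\<^sub>m flip B reg (j + 1)) (f, \<alpha>) \<noteq> None \<and>
              (flip B reg (j + 1) \<circ>\<^sub>m flip B reg j \<circ>\<^sub>m flip B reg (j + 1)) (f, \<alpha>) =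
              (flip B reg j \<circ>\<^sub>m flip B reg (j + 1) \<circ>\<^sub>m flip B reg j) (f, \<alpha>))))"


definition two_parameter_group :: "cvec monoid \<Rightarrow> bool" where
  "two_parameter_group G \<longleftrightarrow>
     group G \<and> open (carrier G) \<and> connected (carrier G) \<and>
     holomorphic2 (\<lambda>a b. a \<otimes>\<^bsub>G\<^esub> b) (carrier G \<times> carrier G) \<and>
     holomorphic1 (\<lambda>a. inv\<^bsub>G\<^esub> a) (carrier G)"

text \<open>
  A local action at every site: \<open>\<Phi> n \<epsilon> f\<close> is defined for \<open>(\<epsilon>, f) \<in> U n\<close>, and the identity acts
  on generic \<open>f\<close>.
\<close>

definition point_transformations ::
    "cvec monoid \<Rightarrow> (site \<Rightarrow> (cvec \<times> cvec) set) \<Rightarrow> (site \<Rightarrow> cvec \<Rightarrow> cvec \<Rightarrow> cvec) \<Rightarrow> bool" where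
  "point_transformations G U \<Phi> \<longleftrightarrow>
     (\<forall>n. open (U n) \<and> U n \<subseteq> carrier G \<times> UNIV \<and>
          generic {f. (\<one>\<^bsub>G\<^esub>, f) \<in> U n} \<and>
          holomorphic2 (\<Phi> n) (U n) \<and>
          (\<forall>\<epsilon> f. (\<epsilon>, f) \<in> U n \<longrightarrow> (\<one>\<^bsub>G\<^esub>, f) \<in> U n) \<and>
          (\<forall>f. (\<one>\<^bsub>G\<^esub>, f) \<in> U n \<longrightarrow> \<Phi> n \<one>\<^bsub>G\<^esub> f = f) \<and>
          (\<forall>\<epsilon> f. (\<epsilon>, f) \<in> U n \<longrightarrow>
             (inv\<^bsub>G\<^esub> \<epsilon>, \<Phi> n \<epsilon> f) \<in> U n \<and> \<Phi> n (inv\<^bsub>G\<^esub> \<epsilon>) (\<Phi> n \<epsilon> f) = f) \<and>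
          (\<forall>\<epsilon> \<delta> f. (\<delta>, f) \<in> U n \<and> (\<epsilon>, \<Phi> n \<delta> f) \<in> U n \<and> (\<epsilon> \<otimes>\<^bsub>G\<^esub> \<delta>, f) \<in> U n \<longrightarrow>
             \<Phi> n \<epsilon> (\<Phi> n \<delta> f) = \<Phi> n (\<epsilon> \<otimes>\<^bsub>G\<^esub> \<delta>) f))"

text \<open>Solutions are mapped to solutions on every elementary square \<open>n, n + e1, n + e2, n + e1 + e2\<close>.\<close>

definition symmetry_group ::
    "cvec monoid \<Rightarrow> (site \<Rightarrow> (cvec \<times> cvec) set) \<Rightarrow> (site \<Rightarrow> cvec \<Rightarrow> cvec \<Rightarrow> cvec) \<Rightarrow>
     quad_system \<Rightarrow> (complex \<times> complex) set \<Rightarrow> bool" where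
  "symmetry_group G U \<Phi> B par \<longleftrightarrow>
     (\<forall>(\<beta>1, \<beta>2)\<in>par. \<forall>n. \<forall>\<epsilon>\<in>carrier G. \<forall>f f1 f2 f12.
        (\<epsilon>, f) \<in> U n \<and> (\<epsilon>, f1) \<in> U (shift1 n) \<and> (\<epsilon>, f2) \<in> U (shift2 n) \<and>
        (\<epsilon>, f12) \<in> U (shift1 (shift2 n)) \<and> B f f1 f2 f12 \<beta>1 \<beta>2 = 0 \<longrightarrow>
        B (\<Phi> n \<epsilon> f) (\<Phi> (shift1 n) \<epsilon> f1) (\<Phi> (shift2 n) \<epsilon> f2)
          (\<Phi> (shift1 (shift2 n)) \<epsilon> f12) \<beta>1 \<beta>2 = 0)"

definition generator ::
    "cvec monoid \<Rightarrow> (site \<Rightarrow> cvec \<Rightarrow> cvec \<Rightarrow> cvec) \<Rightarrow> 2 \<Rightarrow> site \<Rightarrow> cvec \<Rightarrow> cvec" where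
  "generator G \<Phi> a n f = frechet_derivative (\<lambda>\<epsilon>. \<Phi> n \<epsilon> f) (at \<one>\<^bsub>G\<^esub>) (axis a 1)"

text \<open>
  The prolonged generating vector fields are independent at generic points of the
  eight-dimensional space of \<open>(f, f1, f2, f12)\<close>: orbits have dimension two, the orbit space six.
\<close>

definition six_dim_orbit_space ::
    "cvec monoid \<Rightarrow> (site \<Rightarrow> (cvec \<times> cvec) set) \<Rightarrow> (site \<Rightarrow> cvec \<Rightarrow> cvec \<Rightarrow> cvec) \<Rightarrow> bool" where
  "six_dim_orbit_space G U \<Phi> \<longleftrightarrow>
     (\<forall>n. \<exists>N. generic N \<and> (\<forall>(f, f1, f2, f12)\<in>N.
        (\<one>\<^bsub>G\<^esub>, f) \<in> U n \<and> (\<one>\<^bsub>G\<^esub>, f1) \<in> U (shift1 n) \<and> (\<one>\<^bsub>G\<^esub>, f2) \<in> U (shift2 n) \<and>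
        (\<one>\<^bsub>G\<^esub>, f12) \<in> U (shift1 (shift2 n)) \<and>
        (\<forall>c d.
          c *s generator G \<Phi> 1 n f + d *s generator G \<Phi> 2 n f = 0 \<and>
          c *s generator G \<Phi> 1 (shift1 n) f1 + d *s generator G \<Phi> 2 (shift1 n) f1 = 0 \<and>
          c *s generator G \<Phi> 1 (shift2 n) f2 + d *s generator G \<Phi> 2 (shift2 n) f2 = 0 \<and>
          c *s generator G \<Phi> 1 (shift1 (shift2 n)) f12
            + d *s generator G \<Phi> 2 (shift1 (shift2 n)) f12 = 0 \<longrightarrow>
          c = 0 \<and> d = 0)))"


text \<open>
  \<open>I\<close> is defined on \<open>\<Omega>\<close>. The two clauses are the invariance of \<open>I(f, f1)\<close> and of \<open>I(f2, f)\<close>;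
  at shifted sites they cover the two remaining edges of a square.
\<close>

definition lattice_invariants ::
    "cvec monoid \<Rightarrow> (site \<Rightarrow> (cvec \<times> cvec) set) \<Rightarrow> (site \<Rightarrow> cvec \<Rightarrow> cvec \<Rightarrow> cvec) \<Rightarrow>
     (cvec \<times> cvec) set \<Rightarrow> (cvec \<Rightarrow> cvec \<Rightarrow> cvec) \<Rightarrow> bool" where
  "lattice_invariants G U \<Phi> \<Omega> I \<longleftrightarrow>
     generic \<Omega> \<and> holomorphic2 I \<Omega> \<and>
     (\<forall>n. \<forall>\<epsilon>\<in>carrier G.
        (\<forall>f f1. (f, f1) \<in> \<Omega> \<and> (\<epsilon>, f) \<in> U n \<and> (\<epsilon>, f1) \<in> U (shift1 n) \<and>
           (\<Phi> n \<epsilon> f, \<Phi> (shift1 n) \<epsilon> f1) \<in> \<Omega> \<longrightarrow>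
           I (\<Phi> n \<epsilon> f) (\<Phi> (shift1 n) \<epsilon> f1) = I f f1) \<and>
        (\<forall>f f2. (f2, f) \<in> \<Omega> \<and> (\<epsilon>, f2) \<in> U (shift2 n) \<and> (\<epsilon>, f) \<in> U n \<and>
           (\<Phi> (shift2 n) \<epsilon> f2, \<Phi> n \<epsilon> f) \<in> \<Omega> \<longrightarrow>
           I (\<Phi> (shift2 n) \<epsilon> f2) (\<Phi> n \<epsilon> f) = I f2 f))"

definition edges_in ::
    "(cvec \<times> cvec) set \<Rightarrow> cvec \<Rightarrow> cvec \<Rightarrow> cvec \<Rightarrow> cvec \<Rightarrow> bool" where
  "edges_in \<Omega> f f1 f2 f12 \<longleftrightarrow>
     (f, f1) \<in> \<Omega> \<and> (f2, f) \<in> \<Omega> \<and> (f2, f12) \<in> \<Omega> \<and> (f12, f1) \<in> \<Omega>"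

definition invariants_of_quad ::
    "(cvec \<Rightarrow> cvec \<Rightarrow> cvec) \<Rightarrow> cvec \<times> cvec \<times> cvec \<times> cvec \<Rightarrow> cvec \<times> cvec \<times> cvec \<times> cvec" where
  "invariants_of_quad I = (\<lambda>(f, f1, f2, f12). (I f f1, I f2 f, I f2 f12, I f12 f1))"

text \<open>
  The two components of \<open>C\<close> are the relations satisfied by \<open>(x, y, p, q)\<close> on all squares. There
  are exactly two: they are independent, and the eight functions \<open>(x, y, p, q)\<close> have complex
  rank six, that is real rank twelve.
\<close>

definition exactly_two_functional_relations ::
    "(cvec \<times> cvec) set \<Rightarrow> (cvec \<Rightarrow> cvec \<Rightarrow> cvec) \<Rightarrow>
     (cvec \<times> cvec \<times> cvec \<times> cvec \<Rightarrow> complex^2) \<Rightarrow> bool" where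
  "exactly_two_functional_relations \<Omega> I C \<longleftrightarrow>
     (\<forall>f f1 f2 f12. edges_in \<Omega> f f1 f2 f12 \<longrightarrow>
        C (invariants_of_quad I (f, f1, f2, f12)) = 0) \<and>
     (\<exists>N. generic N \<and> (\<forall>(f, f1, f2, f12)\<in>N.
        edges_in \<Omega> f f1 f2 f12 \<and>
        dim (range (frechet_derivative (invariants_of_quad I) (at (f, f1, f2, f12)))) = 12 \<and>
        (\<exists>(Cx :: complex^2^2) (Cy :: complex^2^2) (Cp :: complex^2^2) (Cq :: complex^2^2).
           (C has_derivative (\<lambda>(h, k, l, m). Cx *v h + Cy *v k + Cp *v l + Cq *v m))
             (at (invariants_of_quad I (f, f1, f2, f12))) \<and>
           surj (\<lambda>(h, k, l, m). Cx *v h + Cy *v k + Cp *v l + Cq *v m))))"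

text \<open>
  The further relations \<open>D = 0\<close> given by the system. Only \<open>B = 0 \<Longrightarrow> D = 0\<close> is required: the
  invariants may separate orbits only locally, and then \<open>D = 0\<close> can have more solutions.
\<close>

definition reduced_relations ::
    "quad_system \<Rightarrow> (complex \<times> complex) set \<Rightarrow> triples \<Rightarrow> (cvec \<times> cvec) set \<Rightarrow>
     (cvec \<Rightarrow> cvec \<Rightarrow> cvec) \<Rightarrow>
     (cvec \<times> cvec \<times> cvec \<times> cvec \<Rightarrow> complex \<Rightarrow> complex \<Rightarrow> complex^2) \<Rightarrow> bool" where
  "reduced_relations B par reg \<Omega> I D \<longleftrightarrow>
     (\<forall>(\<beta>1, \<beta>2)\<in>par. \<forall>(f, f1, f2)\<in>reg \<beta>1 \<beta>2. \<forall>f12. B f f1 f2 f12 \<beta>1 \<beta>2 = 0 \<longrightarrow>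
        edges_in \<Omega> f f1 f2 f12 \<and> D (invariants_of_quad I (f, f1, f2, f12)) \<beta>1 \<beta>2 = 0)"

text \<open>
  The partial map of \<open>X \<times> X\<close> sending \<open>(x, y)\<close> to the unique solution \<open>(p, q)\<close> of the four
  relations.
\<close>

definition edge_map ::
    "cvec set \<Rightarrow> (cvec \<times> cvec \<times> cvec \<times> cvec \<Rightarrow> complex^2) \<Rightarrow>
     (cvec \<times> cvec \<times> cvec \<times> cvec \<Rightarrow> complex \<Rightarrow> complex \<Rightarrow> complex^2) \<Rightarrow>
     complex \<Rightarrow> complex \<Rightarrow> cvec \<times> cvec \<rightharpoonup> cvec \<times> cvec" where
  "edge_map X C D \<beta>1 \<beta>2 = (\<lambda>(x, y).
     let sol = (\<lambda>(p, q). p \<in> X \<and> q \<in> X \<and> C (x, y, p, q) = 0 \<and> D (x, y, p, q) \<beta>1 \<beta>2 = 0)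
     in if x \<in> X \<and> y \<in> X \<and> (\<exists>!pq. sol pq) then Some (THE pq. sol pq) else None)"


definition act12 :: "('a \<times> 'a \<rightharpoonup> 'a \<times> 'a) \<Rightarrow> 'a \<times> 'a \<times> 'a \<rightharpoonup> 'a \<times> 'a \<times> 'a" where
  "act12 R = (\<lambda>(x, y, z). map_option (\<lambda>(p, q). (p, q, z)) (R (x, y)))"

definition act13 :: "('a \<times> 'a \<rightharpoonup> 'a \<times> 'a) \<Rightarrow> 'a \<times> 'a \<times> 'a \<rightharpoonup> 'a \<times> 'a \<times> 'a" where
  "act13 R = (\<lambda>(x, y, z). map_option (\<lambda>(p, q). (p, y, q)) (R (x, z)))"

definition act23 :: "('a \<times> 'a \<rightharpoonup> 'a \<times> 'a) \<Rightarrow> 'a \<times> 'a \<times> 'a \<rightharpoonup> 'a \<times> 'a \<times> 'a" where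
  "act23 R = (\<lambda>(x, y, z). map_option (\<lambda>(p, q). (x, p, q)) (R (y, z)))"

text \<open>Both sides are defined at the given triple and agree there.\<close>

definition yang_baxter_at ::
    "(complex \<Rightarrow> complex \<Rightarrow> 'a \<times> 'a \<rightharpoonup> 'a \<times> 'a) \<Rightarrow> complex \<Rightarrow> complex \<Rightarrow> complex \<Rightarrow>
     'a \<times> 'a \<times> 'a \<Rightarrow> bool" where
  "yang_baxter_at R \<beta>1 \<beta>2 \<beta>3 t \<longleftrightarrow>
     (act23 (R \<beta>2 \<beta>3) \<circ>\<^sub>m act13 (R \<beta>1 \<beta>3) \<circ>\<^sub>m act12 (R \<beta>1 \<beta>2)) t \<noteq> None \<and>
     (act23 (R \<beta>2 \<beta>3) \<circ>\<^sub>m act13 (R \<beta>1 \<beta>3) \<circ>\<^sub>m act12 (R \<beta>1 \<beta>2)) t =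
     (act12 (R \<beta>1 \<beta>2) \<circ>\<^sub>m act13 (R \<beta>1 \<beta>3) \<circ>\<^sub>m act23 (R \<beta>2 \<beta>3)) t"

end

theory Submission
  imports Defs
begin

text \<open>
  Attach to each edge of a path of vertices the invariant \<open>I\<close> evaluated at its two ends. An elementary
  flip changes one vertex, hence only the invariants of the two edges meeting there. Regard an
  edge as carrying its direction with it: the flip exchanges the two directions, and it moves the
  invariants \<open>(x, y)\<close> of the old edges to the invariants \<open>(p, q)\<close> of the parallel new edges.
  All four edges belong to one elementary square of a solution, so \<open>(p, q)\<close> solves the four relations
  that define the edge map \<open>R\<close>, and by uniqueness \<open>(p, q) = R(x, y)\<close>. This is
  \<open>flip_acts_by_edge_map\<close>.

  Now deform a path with three edges across a cube. Labelling the invariants by direction rather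
  than by position along the path, the flips at the vertices \<open>1, 2, 1\<close> exchange the
  direction pairs \<open>(1,2), (1,3), (2,3)\<close> in this order, and the flips at \<open>2, 1, 2\<close> exchange them in
  the opposite order. These two deformations therefore induce on the triple of invariants the two
  sides of the Yang-Baxter relation, and three-dimensional consistency says that they end at the
  same path, thus at the same invariants.
\<close>

text \<open>
  Uniqueness does the work: the invariants on a square of a solution satisfy all four relations,
  so wherever the edge map is defined they have to be its value.
\<close>

lemma edge_map_on_square:
  assumes rel: "exactly_two_functional_relations \<Omega> I C"
    and red: "reduced_relations B par reg \<Omega> I D"
    and par: "(\<beta>1, \<beta>2) \<in> par"
    and reg: "(f, f1, f2) \<in> reg \<beta>1 \<beta>2"
    and dom: "(I f f1, I f2 f) \<in> dom (edge_map (case_prod I ` \<Omega>) C D \<beta>1 \<beta>2)"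
    and sq: "B f f1 f2 f12 \<beta>1 \<beta>2 = 0"
  shows "edge_map (case_prod I ` \<Omega>) C D \<beta>1 \<beta>2 (I f f1, I f2 f) = Some (I f2 f12, I f12 f1)"
proof -
  define sol where "sol = (\<lambda>(p, q). p \<in> case_prod I ` \<Omega> \<and> q \<in> case_prod I ` \<Omega> \<and>
    C (I f f1, I f2 f, p, q) = 0 \<and> D (I f f1, I f2 f, p, q) \<beta>1 \<beta>2 = 0)"
  have edges: "edges_in \<Omega> f f1 f2 f12"
    and D0: "D (invariants_of_quad I (f, f1, f2, f12)) \<beta>1 \<beta>2 = 0"
    using red par reg sq unfolding reduced_relations_def by blast+
  have C0: "C (invariants_of_quad I (f, f1, f2, f12)) = 0"
    using rel edges unfolding exactly_two_functional_relations_def by blast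
  have sol: "sol (I f2 f12, I f12 f1)"
    using edges C0 D0 by (force simp: sol_def edges_in_def invariants_of_quad_def)
  have unfolded: "edge_map (case_prod I ` \<Omega>) C D \<beta>1 \<beta>2 (I f f1, I f2 f) =
      (if I f f1 \<in> case_prod I ` \<Omega> \<and> I f2 f \<in> case_prod I ` \<Omega> \<and> (\<exists>!pq. sol pq)
       then Some (THE pq. sol pq) else None)"
    by (simp add: edge_map_def sol_def Let_def)
  with dom have "\<exists>!pq. sol pq"
    and edge_map_value: "edge_map (case_prod I ` \<Omega>) C D \<beta>1 \<beta>2 (I f f1, I f2 f) = Some (THE pq. sol pq)"
    by (auto split: if_splits)
  with sol have "(THE pq. sol pq) = (I f2 f12, I f12 f1)"
    by (blast intro: the1_equality)
  with edge_map_value show ?thesis by simp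
qed

text \<open>
  The arguments of \<open>I\<close> are in descending order because the edges of a square are read as
  \<open>I(f, f1)\<close> and \<open>I(f2, f)\<close>, where the path runs from \<open>f1\<close> through \<open>f\<close> to \<open>f2\<close>.
\<close>

definition path_invariant :: "('a \<Rightarrow> 'a \<Rightarrow> 'b) \<Rightarrow> (nat \<Rightarrow> 'a) \<Rightarrow> nat \<Rightarrow> 'b" where
  "path_invariant I f j = I (f (Suc j)) (f j)"

text \<open>
  The pair is swapped in the last conclusion because the edge map keeps track of directions
  and the path keeps track of positions: after the flip the first direction is met second.
\<close>

lemma flip_acts_by_edge_map:
  assumes solv: "solvable B par reg"
    and rel: "exactly_two_functional_relations \<Omega> I C"
    and red: "reduced_relations B par reg \<Omega> I D"
    and dom: "\<forall>(\<beta>1, \<beta>2)\<in>par. \<forall>(f, f1, f2)\<in>reg \<beta>1 \<beta>2.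
           (I f f1, I f2 f) \<in> dom (edge_map (case_prod I ` \<Omega>) C D \<beta>1 \<beta>2)"
    and par: "(\<alpha> k, \<alpha> (Suc k)) \<in> par"
    and flip: "flip B reg (Suc k) (f, \<alpha>) = Some (f', \<alpha>')"
  shows "\<alpha>' = \<alpha>(k := \<alpha> (Suc k), Suc k := \<alpha> k)"
    and "\<And>j. j \<noteq> k \<Longrightarrow> j \<noteq> Suc k \<Longrightarrow> path_invariant I f' j = path_invariant I f j"
    and "edge_map (case_prod I ` \<Omega>) C D (\<alpha> k) (\<alpha> (Suc k))
           (path_invariant I f k, path_invariant I f (Suc k)) =
         Some (path_invariant I f' (Suc k), path_invariant I f' k)"
proof -
  define g where
    "g = (THE g. B (f (Suc k)) (f k) (f (Suc (Suc k))) g (\<alpha> k) (\<alpha> (Suc k)) = 0)"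
  have reg: "(f (Suc k), f k, f (Suc (Suc k))) \<in> reg (\<alpha> k) (\<alpha> (Suc k))"
    and f': "f' = f(Suc k := g)"
    and \<alpha>': "\<alpha>' = \<alpha>(k := \<alpha> (Suc k), Suc k := \<alpha> k)"
    using flip by (auto simp: flip_def g_def split: if_splits)
  have "\<exists>!g. B (f (Suc k)) (f k) (f (Suc (Suc k))) g (\<alpha> k) (\<alpha> (Suc k)) = 0"
    using solv par reg unfolding solvable_def by blast
  then have "B (f (Suc k)) (f k) (f (Suc (Suc k))) g (\<alpha> k) (\<alpha> (Suc k)) = 0"
    unfolding g_def by (rule theI')
  moreover have "(I (f (Suc k)) (f k), I (f (Suc (Suc k))) (f (Suc k)))
      \<in> dom (edge_map (case_prod I ` \<Omega>) C D (\<alpha> k) (\<alpha> (Suc k)))"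
    using dom par reg by blast
  ultimately have "edge_map (case_prod I ` \<Omega>) C D (\<alpha> k) (\<alpha> (Suc k))
        (I (f (Suc k)) (f k), I (f (Suc (Suc k))) (f (Suc k))) =
      Some (I (f (Suc (Suc k))) g, I g (f k))"
    by (intro edge_map_on_square[OF rel red par reg])
  then
  show "edge_map (case_prod I ` \<Omega>) C D (\<alpha> k) (\<alpha> (Suc k))
          (path_invariant I f k, path_invariant I f (Suc k)) =
        Some (path_invariant I f' (Suc k), path_invariant I f' k)"
    by (simp add: path_invariant_def f')
  show "\<alpha>' = \<alpha>(k := \<alpha> (Suc k), Suc k := \<alpha> k)" by (fact \<alpha>')
  show "path_invariant I f' j = path_invariant I f j" if "j \<noteq> k" "j \<noteq> Suc k" for j
    using that by (simp add: path_invariant_def f')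
qed

theorem proposition4p1:
  fixes B :: quad_system
    and par :: "(complex \<times> complex) set"
    and reg :: triples
    and G :: "cvec monoid"
    and U :: "site \<Rightarrow> (cvec \<times> cvec) set"
    and \<Phi> :: "site \<Rightarrow> cvec \<Rightarrow> cvec \<Rightarrow> cvec"
    and \<Omega> :: "(cvec \<times> cvec) set"
    and I :: "cvec \<Rightarrow> cvec \<Rightarrow> cvec"
    and C :: "cvec \<times> cvec \<times> cvec \<times> cvec \<Rightarrow> complex^2"
    and D :: "cvec \<times> cvec \<times> cvec \<times> cvec \<Rightarrow> complex \<Rightarrow> complex \<Rightarrow> complex^2"
    and R :: "complex \<Rightarrow> complex \<Rightarrow> cvec \<times> cvec \<rightharpoonup> cvec \<times> cvec"
  defines "R \<equiv> edge_map (case_prod I ` \<Omega>) C D"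
  assumes "solvable B par reg"
    and "three_dim_consistent B par reg"
    and "two_parameter_group G"
    and "point_transformations G U \<Phi>"
    and "six_dim_orbit_space G U \<Phi>"
    and "symmetry_group G U \<Phi> B par"
    and "lattice_invariants G U \<Phi> \<Omega> I"
    and "exactly_two_functional_relations \<Omega> I C"
    and "reduced_relations B par reg \<Omega> I D"
    and "\<And>\<beta>1 \<beta>2 f f1 f2. (\<beta>1, \<beta>2) \<in> par \<Longrightarrow> (f, f1, f2) \<in> reg \<beta>1 \<beta>2 \<Longrightarrow>
           (I f f1, I f2 f) \<in> dom (R \<beta>1 \<beta>2)"
  shows "\<forall>\<beta>1 \<beta>2 \<beta>3. (\<beta>1, \<beta>2) \<in> par \<and> (\<beta>1, \<beta>3) \<in> par \<and> (\<beta>2, \<beta>3) \<in> par \<longrightarrow>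
           (\<exists>W. generic W \<and>
             (\<forall>(f1, f2, f3, f4)\<in>W.
                yang_baxter_at R \<beta>1 \<beta>2 \<beta>3 (I f2 f1, I f3 f2, I f4 f3)))"
proof (intro allI impI, elim conjE)
  fix \<beta>1 \<beta>2 \<beta>3
  assume par: "(\<beta>1, \<beta>2) \<in> par" "(\<beta>1, \<beta>3) \<in> par" "(\<beta>2, \<beta>3) \<in> par"
  let ?e = "path_invariant I"
  have dom: "\<forall>(\<beta>1, \<beta>2)\<in>par. \<forall>(f, f1, f2)\<in>reg \<beta>1 \<beta>2. (I f f1, I f2 f) \<in> dom (R \<beta>1 \<beta>2)"
    using assms(11) by blast
  note step = flip_acts_by_edge_map[where \<Omega> = \<Omega> and I = I and C = C and D = D, folded R_def,
      OF assms(2) assms(9) assms(10) dom]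
  obtain W where W: "generic W" and consistent:
    "\<And>f \<alpha> j. j \<ge> 1 \<and> \<alpha> (j - 1) = \<beta>1 \<and> \<alpha> j = \<beta>2 \<and> \<alpha> (j + 1) = \<beta>3 \<and>
       (f (j - 1), f j, f (j + 1), f (j + 2)) \<in> W \<Longrightarrow>
       (flip B reg (j + 1) \<circ>\<^sub>m flip B reg j \<circ>\<^sub>m flip B reg (j + 1)) (f, \<alpha>) \<noteq> None \<and>
       (flip B reg (j + 1) \<circ>\<^sub>m flip B reg j \<circ>\<^sub>m flip B reg (j + 1)) (f, \<alpha>) =
       (flip B reg j \<circ>\<^sub>m flip B reg (j + 1) \<circ>\<^sub>m flip B reg j) (f, \<alpha>)"
    using assms(3) par unfolding three_dim_consistent_def by meson
  have "yang_baxter_at R \<beta>1 \<beta>2 \<beta>3 (I f2 f1, I f3 f2, I f4 f3)"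
    if "(f1, f2, f3, f4) \<in> W" for f1 f2 f3 f4
  proof -
    \<comment> \<open>Only the vertices \<open>0, ..., 3\<close> and the edges \<open>0, 1, 2\<close> of the path matter; it is continued
      by constants.\<close>
    define f where "f = (\<lambda>j::nat. if j = 0 then f1 else if j = 1 then f2 else if j = 2 then f3 else f4)"
    define \<alpha> where "\<alpha> = (\<lambda>j::nat. if j = 0 then \<beta>1 else if j = 1 then \<beta>2 else \<beta>3)"
    have start: "?e f 0 = I f2 f1" "?e f (Suc 0) = I f3 f2" "?e f (Suc (Suc 0)) = I f4 f3"
      by (simp_all add: path_invariant_def f_def)
    have "(1::nat) \<ge> 1 \<and> \<alpha> (1 - 1) = \<beta>1 \<and> \<alpha> 1 = \<beta>2 \<and> \<alpha> (1 + 1) = \<beta>3 \<and>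
        (f (1 - 1), f 1, f (1 + 1), f (1 + 2)) \<in> W"
      using that by (simp add: f_def \<alpha>_def)
    from consistent[OF this]
    have "(flip B reg 2 \<circ>\<^sub>m flip B reg 1 \<circ>\<^sub>m flip B reg 2) (f, \<alpha>) \<noteq> None \<and>
      (flip B reg 2 \<circ>\<^sub>m flip B reg 1 \<circ>\<^sub>m flip B reg 2) (f, \<alpha>) =
      (flip B reg 1 \<circ>\<^sub>m flip B reg 2 \<circ>\<^sub>m flip B reg 1) (f, \<alpha>)"
      unfolding one_add_one .
    then obtain h \<gamma> where
      end1: "(flip B reg 1 \<circ>\<^sub>m flip B reg 2 \<circ>\<^sub>m flip B reg 1) (f, \<alpha>) = Some (h, \<gamma>)" and
      end2: "(flip B reg 2 \<circ>\<^sub>m flip B reg 1 \<circ>\<^sub>m flip B reg 2) (f, \<alpha>) = Some (h, \<gamma>)"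
      by (metis option.exhaust surj_pair)
    from end1 obtain a \<delta> b \<epsilon> where 121:
      "flip B reg (Suc 0) (f, \<alpha>) = Some (a, \<delta>)"
      "flip B reg (Suc (Suc 0)) (a, \<delta>) = Some (b, \<epsilon>)"
      "flip B reg (Suc 0) (b, \<epsilon>) = Some (h, \<gamma>)"
      by (auto simp: map_comp_Some_iff numeral_2_eq_2)
    from end2 obtain c \<zeta> d \<eta> where 212:
      "flip B reg (Suc (Suc 0)) (f, \<alpha>) = Some (c, \<zeta>)"
      "flip B reg (Suc 0) (c, \<zeta>) = Some (d, \<eta>)"
      "flip B reg (Suc (Suc 0)) (d, \<eta>) = Some (h, \<gamma>)"
      by (auto simp: map_comp_Some_iff numeral_2_eq_2)
    \<comment> \<open>Each flip needs the parameters that the previous one has left on its two edges.\<close>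
    have \<alpha>: "\<alpha> 0 = \<beta>1" "\<alpha> (Suc 0) = \<beta>2" "\<alpha> (Suc (Suc 0)) = \<beta>3" by (simp_all add: \<alpha>_def)
    have p1: "(\<alpha> 0, \<alpha> (Suc 0)) \<in> par" using par by (simp add: \<alpha>)
    note s1 = step[OF p1 121(1)]
    have \<delta>: "\<delta> 0 = \<beta>2" "\<delta> (Suc 0) = \<beta>1" "\<delta> (Suc (Suc 0)) = \<beta>3" by (simp_all add: s1(1) \<alpha>)
    have p2: "(\<delta> (Suc 0), \<delta> (Suc (Suc 0))) \<in> par" using par by (simp add: \<delta>)
    note s2 = step[OF p2 121(2)]
    have \<epsilon>: "\<epsilon> 0 = \<beta>2" "\<epsilon> (Suc 0) = \<beta>3" by (simp_all add: s2(1) \<delta>)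
    have p3: "(\<epsilon> 0, \<epsilon> (Suc 0)) \<in> par" using par by (simp add: \<epsilon>)
    note s3 = step[OF p3 121(3)]
    have q1: "(\<alpha> (Suc 0), \<alpha> (Suc (Suc 0))) \<in> par" using par by (simp add: \<alpha>)
    note t1 = step[OF q1 212(1)]
    have \<zeta>: "\<zeta> 0 = \<beta>1" "\<zeta> (Suc 0) = \<beta>3" "\<zeta> (Suc (Suc 0)) = \<beta>2" by (simp_all add: t1(1) \<alpha>)
    have q2: "(\<zeta> 0, \<zeta> (Suc 0)) \<in> par" using par by (simp add: \<zeta>)
    note t2 = step[OF q2 212(2)]
    have \<eta>: "\<eta> (Suc 0) = \<beta>1" "\<eta> (Suc (Suc 0)) = \<beta>2" by (simp_all add: t2(1) \<zeta>)
    have q3: "(\<eta> (Suc 0), \<eta> (Suc (Suc 0))) \<in> par" using par by (simp add: \<eta>)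
    note t3 = step[OF q3 212(3)]
    \<comment> \<open>The final path meets the directions in the order \<open>3, 2, 1\<close>, so its invariants appear
      reversed.\<close>
    let ?final = "Some (?e h (Suc (Suc 0)), ?e h (Suc 0), ?e h 0)"
    have "(act23 (R \<beta>2 \<beta>3) \<circ>\<^sub>m act13 (R \<beta>1 \<beta>3) \<circ>\<^sub>m act12 (R \<beta>1 \<beta>2)) (?e f 0, ?e f (Suc 0), ?e f (Suc (Suc 0))) = ?final"
      using s1(3) s2(3) s3(3) s1(2)[of "Suc (Suc 0)"] s2(2)[of 0] s3(2)[of "Suc (Suc 0)"]
      by (simp add: map_comp_def act12_def act13_def act23_def \<alpha> \<delta> \<epsilon>)
    moreover have "(act12 (R \<beta>1 \<beta>2) \<circ>\<^sub>m act13 (R \<beta>1 \<beta>3) \<circ>\<^sub>m act23 (R \<beta>2 \<beta>3)) (?e f 0, ?e f (Suc 0), ?e f (Suc (Suc 0))) = ?final"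
      using t1(3) t2(3) t3(3) t1(2)[of 0] t2(2)[of "Suc (Suc 0)"] t3(2)[of 0]
      by (simp add: map_comp_def act12_def act13_def act23_def \<alpha> \<zeta> \<eta>)
    ultimately show ?thesis
      unfolding yang_baxter_at_def start by simp
  qed
  with W show "\<exists>W. generic W \<and>
      (\<forall>(f1, f2, f3, f4)\<in>W. yang_baxter_at R \<beta>1 \<beta>2 \<beta>3 (I f2 f1, I f3 f2, I f4 f3))"
    by blast
qed

end
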